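(* Let $(X,\leq_X)$ be a well-quasi-order with decidable order relation, and let $G\colon X^\omega\to((\mathbb{N}^{\mathbb{N}}\to\mathbb{N})\to(\mathbb{N}\to\mathbb{N}))$ be a functional satisfying $\forall x\in X^\omega\,\forall\varphi\colon\mathbb{N}^{\mathbb{N}}\to\mathbb{N}\;\forall i<j\leq\varphi(G^x_\varphi)\,(G^x_\varphi i<G^x_\varphi j\wedge x_{G^x_\varphi i}\leq_X x_{G^x_\varphi j})$. Let $\Gamma\colon(X^\ast)^\omega\to\mathbb{N}$ be defined as follows. For $\mathbf{p}\colon((X^\ast)^\omega)^\omega$ and $\mathbf{f}\colon((X^\ast)^\omega\to\mathbb{N})^\omega$, let $\varphi_{\mathbf{p},\mathbf{f}}:=\lambda g.\,\mathbf{f}^{g0}\big(\mathbf{p}^{g0-1}[g0]\ast(\mathrm{fts}(\mathbf{p})_{gi})_{i\in\mathbb{N}}\big)$ and $G_{\mathbf{p},\mathbf{f}}:=G^{\mathrm{lts}(\mathbf{p})}_{\varphi_{\mathbf{p},\mathbf{f}}}$; writing $G$ for $G_{\mathbf{p},\mathbf{f}}$ and $\varphi$ for $\varphi_{\mathbf{p},\mathbf{f}}$, set $\Omega(\mathbf{p},\mathbf{f}):=G(\varphi G)+1$, $\Phi(\mathbf{p},\mathbf{f}):=G(\varphi G)+1$, $\Psi(\mathbf{p},\mathbf{f}):=\mathbf{p}^{G0-1}[G0]\ast(\mathrm{fts}(\mathbf{p})_{Gi})_{i\in\mathbb{N}}$. Then $\Gamma(u):=\Phi(\mathbf{p}_u,\mathbf{f}_u)$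 where $\mathbf{p}_u,\mathbf{f}_u:=\mathsf{EPS}^{\Omega}_{\tilde\varepsilon^u}(\langle\Phi,\Psi\rangle)(\langle\rangle)$. Then for every sequence of words $u\in(X^\ast)^\omega$ there exist $i_0<i_1\leq\Gamma(u)$ with $u_{i_0}\leq_{X^\ast}u_{i_1}$.
   Context: A preorder is a well-quasi-order if every infinite sequence $(x_i)$ has $x_i\leq_X x_j$ for some $i<j$. $X^\ast$ is the set of finite words over $X$ with the embeddability preorder: $\langle x_0,\ldots,x_{m-1}\rangle\leq_{X^\ast}\langle x'_0,\ldots,x'_{n-1}\rangle$ iff there is a strictly increasing $f\colon\{0,\ldots,m-1\}\to\{0,\ldots,n-1\}$ with $x_i\leq_X x'_{f(i)}$ for all $i<m$. For a sequence $\alpha$, $\alpha[n]$ is its initial segment of length $n$ (empty for $n=0$); $s\ast\alpha$ is concatenation. For a nonempty word $x$ write $x=\mathrm{init}(x)\ast\langle\mathrm{last}(x)\rangle$, and set $\mathrm{init}(\langle\rangle):=\langle\rangle$, $\mathrm{last}(\langle\rangle):=0_X$ (a fixed element of $X$). For $\mathbf{p}=(\mathbf{p}^i)_i$ with $\mathbf{p}^i\in(X^\ast)^\omega$: $\mathrm{fts}(\mathbf{p})_i:=\mathrm{init}(\mathbf{p}^i_i)$ and $\mathrm{lts}(\mathbf{p})_i:=\mathrm{last}(\mathbf{p}^i_i)$. For words: $a\unlhd b$ means $|a|\leq|b|$ and $a_i=b_i$ for $i<|a|$. For sequences of words $r,w$: $r\sqsubseteq_n w$ means $r[n]=w[n]\wedge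 r_n\unlhd w_n$. $\theta(v,j)$ means $\forall i_0<i_1\leq j\,(v_{i_0}\not\leq_{X^\ast}v_{i_1})$. Let $Y:=(X^\ast)^\omega\times((X^\ast)^\omega\to\mathbb{N})$; functionals into products are written as pairs, e.g. $\langle\Phi,\Psi\rangle\colon Y^\omega\to\mathbb{N}\times(X^\ast)^\omega$, and sequences in $Y^\omega$ as pairs $\mathbf{p},\mathbf{f}$ of component sequences. For $n\in\mathbb{N}$, $w\in(X^\ast)^\omega$, let $A^{n,w}_m(r,i):\equiv r\sqsubseteq_n w\wedge|r_n|<m\wedge\theta(r,i)$, and define $\varepsilon_{n,w}\colon(Y\to\mathbb{N}\times(X^\ast)^\omega)\to Y$ by: given $J\colon Y\to\mathbb{N}$, $Q\colon Y\to(X^\ast)^\omega$, set $f_0:=$ the constant zero function, $f_i:=\lambda q.\,J(q,f_{i-1})$, $p_{|w_n|}:=w$, $p_{i-1}:=Q(p_i,f_i)$ (for $i\leq|w_n|$), and $\varepsilon_{n,w}\langle J,Q\rangle:=\langle p_i,f_i\rangle$ for the greatest $i\leq|w_n|$ with $\neg A^{n,w}_i(Q(p_i,f_i),f_i(Q(p_i,f_i)))$. For $u\in(X^\ast)^\omega$, $\tilde\varepsilon^u_{\langle P,F\rangle}\langle J,Q\rangle:=\varepsilon_{|\langle P,F\rangle|,P^{|\langle P,F\rangle|-1}}\langle J,Q\rangle$ for finite $\langle P,F\rangle\in Y^\ast$, with $P^{-1}:=u$. Product of selection functions: for $\varepsilon\colon Z^\ast\to((Z\to R)\to Z)$, $q\colon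 Z^\omega\to R$, $\varphi\colon Z^\omega\to\mathbb{N}$, $s\in Z^\ast$: $\mathsf{EPS}^{\varphi}_{\varepsilon}(q)(s)$ is the constant sequence $0_Z$ if $\varphi(\hat s)<|s|$, and otherwise $a_s\ast\mathsf{EPS}^{\varphi}_{\varepsilon}(q_{a_s})(s\ast a_s)$ with $a_s:=\varepsilon_s(\lambda x.\,q_x(\mathsf{EPS}^{\varphi}_{\varepsilon}(q_x)(s\ast x)))$, $q_x(\alpha):=q(x\ast\alpha)$, and $\hat s$ the extension of $s$ by canonical elements $0_Z$. *)

theory Defs
  imports Complex_Main "HOL-Library.Omega_Words_Fun"
begin

text \<open>
  Infinite sequences are functions on \<^typ>\<open>nat\<close>. From \<^theory>\<open>HOL-Library.Omega_Words_Fun\<close> we take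
  the concatenation \<^term>\<open>s \<frown> \<alpha>\<close> of a list with a sequence, and \<^term>\<open>prefix n \<alpha>\<close>, the initial
  segment of length \<open>n\<close>.
\<close>

section \<open>Well-quasi-orders and words\<close>

definition wqo :: "('x \<Rightarrow> 'x \<Rightarrow> bool) \<Rightarrow> bool" where
  "wqo le \<longleftrightarrow> reflp le \<and> transp le \<and> (\<forall>x :: nat \<Rightarrow> 'x. \<exists>i j. i < j \<and> le (x i) (x j))"

definition word_le :: "('x \<Rightarrow> 'x \<Rightarrow> bool) \<Rightarrow> 'x list \<Rightarrow> 'x list \<Rightarrow> bool" where
  "word_le le a b \<longleftrightarrow>
     (\<exists>f. f ` {..<length a} \<subseteq> {..<length b} \<and> strict_mono_on {..<length a} f \<and>
          (\<forall>i<length a. le (a ! i) (b ! f i)))"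

text \<open>\<^const>\<open>butlast\<close> already maps the empty word to itself; \<open>x0\<close> is the fixed element of the alphabet.\<close>

definition last_default :: "'x \<Rightarrow> 'x list \<Rightarrow> 'x" where
  "last_default x0 a = (if a = [] then x0 else last a)"

definition fts :: "(nat \<Rightarrow> nat \<Rightarrow> 'x list) \<Rightarrow> nat \<Rightarrow> 'x list" where
  "fts p i = butlast (p i i)"

definition lts :: "'x \<Rightarrow> (nat \<Rightarrow> nat \<Rightarrow> 'x list) \<Rightarrow> nat \<Rightarrow> 'x" where
  "lts x0 p i = last_default x0 (p i i)"

definition ext :: "'x list \<Rightarrow> 'x list \<Rightarrow> bool" where
  "ext a b \<longleftrightarrow> length a \<le> length b \<and> (\<forall>i<length a. a ! i = b ! i)"

definition ext_at :: "nat \<Rightarrow> (nat \<Rightarrow> 'x list) \<Rightarrow> (nat \<Rightarrow> 'x list) \<Rightarrow> bool" where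
  "ext_at n r w \<longleftrightarrow> prefix n r = prefix n w \<and> ext (r n) (w n)"

definition theta :: "('x \<Rightarrow> 'x \<Rightarrow> bool) \<Rightarrow> (nat \<Rightarrow> 'x list) \<Rightarrow> nat \<Rightarrow> bool" where
  "theta le v j \<longleftrightarrow> (\<forall>i0 i1. i0 < i1 \<and> i1 \<le> j \<longrightarrow> \<not> word_le le (v i0) (v i1))"


section \<open>The selection functions\<close>

type_synonym 'x W = "nat \<Rightarrow> 'x list"
type_synonym 'x Y = "'x W \<times> ('x W \<Rightarrow> nat)"

definition zeroY :: "'x Y" where
  "zeroY = ((\<lambda>_. []), (\<lambda>_. 0))"

definition A_pred ::
  "('x \<Rightarrow> 'x \<Rightarrow> bool) \<Rightarrow> nat \<Rightarrow> 'x W \<Rightarrow> nat \<Rightarrow> 'x W \<Rightarrow> nat \<Rightarrow> bool" where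
  "A_pred le n w m r i \<longleftrightarrow> ext_at n r w \<and> length (r n) < m \<and> theta le r i"

fun sel_f :: "('x Y \<Rightarrow> nat) \<Rightarrow> nat \<Rightarrow> 'x W \<Rightarrow> nat" where
  "sel_f J 0 = (\<lambda>_. 0)"
| "sel_f J (Suc i) = (\<lambda>q. J (q, sel_f J i))"

text \<open>The sequence \<open>p\<close> is given by downward recursion from index \<open>N = |w\<^sub>n|\<close>;
  \<open>sel_p_down J Q w N k\<close> is \<open>p\<close> at index \<open>N - k\<close>.\<close>

fun sel_p_down ::
  "('x Y \<Rightarrow> nat) \<Rightarrow> ('x Y \<Rightarrow> 'x W) \<Rightarrow> 'x W \<Rightarrow> nat \<Rightarrow> nat \<Rightarrow> 'x W" where
  "sel_p_down J Q w N 0 = w"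
| "sel_p_down J Q w N (Suc k) = Q (sel_p_down J Q w N k, sel_f J (N - k))"

definition sel_p ::
  "('x Y \<Rightarrow> nat) \<Rightarrow> ('x Y \<Rightarrow> 'x W) \<Rightarrow> 'x W \<Rightarrow> nat \<Rightarrow> nat \<Rightarrow> 'x W" where
  "sel_p J Q w N i = sel_p_down J Q w N (N - i)"

text \<open>The greatest element below exists because \<open>A_pred le n w 0\<close> is never satisfied.\<close>

definition eps ::
  "('x \<Rightarrow> 'x \<Rightarrow> bool) \<Rightarrow> nat \<Rightarrow> 'x W \<Rightarrow> ('x Y \<Rightarrow> nat \<times> 'x W) \<Rightarrow> 'x Y" where
  "eps le n w K =
     (let J = (\<lambda>y. fst (K y)); Q = (\<lambda>y. snd (K y)); N = length (w n);
          f = sel_f J; p = sel_p J Q w N;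
          i = (GREATEST i. i \<le> N \<and>
                 \<not> A_pred le n w i (Q (p i, f i)) (f i (Q (p i, f i))))
      in (p i, f i))"

definition eps_tilde ::
  "('x \<Rightarrow> 'x \<Rightarrow> bool) \<Rightarrow> 'x W \<Rightarrow> 'x Y list \<Rightarrow> ('x Y \<Rightarrow> nat \<times> 'x W) \<Rightarrow> 'x Y" where
  "eps_tilde le u s =
     eps le (length s) (if s = [] then u else fst (s ! (length s - 1)))"


section \<open>The product of selection functions\<close>

definition shift_arg :: "((nat \<Rightarrow> 'z) \<Rightarrow> 'r) \<Rightarrow> 'z list \<Rightarrow> (nat \<Rightarrow> 'z) \<Rightarrow> 'r" where
  "shift_arg q s = (\<lambda>\<alpha>. q (s \<frown> \<alpha>))"

definition EPS_rhs ::
  "'z \<Rightarrow> ((nat \<Rightarrow> 'z) \<Rightarrow> nat) \<Rightarrow> ('z list \<Rightarrow> ('z \<Rightarrow> 'r) \<Rightarrow> 'z) \<Rightarrow>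
   (((nat \<Rightarrow> 'z) \<Rightarrow> 'r) \<Rightarrow> 'z list \<Rightarrow> nat \<Rightarrow> 'z) \<Rightarrow>
   ((nat \<Rightarrow> 'z) \<Rightarrow> 'r) \<Rightarrow> 'z list \<Rightarrow> nat \<Rightarrow> 'z" where
  "EPS_rhs zero \<phi> \<epsilon> E q s =
     (if \<phi> (s \<frown> (\<lambda>_. zero)) < length s then (\<lambda>_. zero)
      else let a = \<epsilon> s (\<lambda>x. shift_arg q [x] (E (shift_arg q [x]) (s @ [x])))
           in [a] \<frown> E (shift_arg q [a]) (s @ [a]))"

text \<open>
  The equation for \<open>EPS\<close> is a bar recursion. It need not be well-founded for discontinuous \<open>\<phi>\<close>, so
  in the full function space it does not in general define a total functional, and \<open>EPS\<close> is only available
  in type structures such as the continuous functionals. We therefore treat \<open>EPS\<close> as a given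
  functional which satisfies its defining equation, and let \<open>Z\<close> be the set of objects of the type
  \<open>'z\<close> which exist in the type structure at hand (\<open>Z = UNIV\<close> being the full one). The equation
  is only required for the arguments that occur in the evaluation of \<open>EPS \<phi> \<epsilon> q []\<close>, which are
  the pairs \<open>q\<^sub>s, s\<close> with \<open>q\<^sub>s \<alpha> = q (s \<frown> \<alpha>)\<close>.
  Theorem \<open>EPS_exists\<close> below shows that this is satisfied, with \<open>Z\<close> the continuous
  objects, whenever \<open>G\<close> is a continuous functional.
\<close>

definition is_EPS ::
  "'z set \<Rightarrow> 'z \<Rightarrow>
   (((nat \<Rightarrow> 'z) \<Rightarrow> nat) \<Rightarrow> ('z list \<Rightarrow> ('z \<Rightarrow> 'r) \<Rightarrow> 'z) \<Rightarrow>
      ((nat \<Rightarrow> 'z) \<Rightarrow> 'r) \<Rightarrow> 'z list \<Rightarrow> nat \<Rightarrow> 'z) \<Rightarrow>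
   ((nat \<Rightarrow> 'z) \<Rightarrow> nat) \<Rightarrow> ('z list \<Rightarrow> ('z \<Rightarrow> 'r) \<Rightarrow> 'z) \<Rightarrow> ((nat \<Rightarrow> 'z) \<Rightarrow> 'r) \<Rightarrow> bool"
where
  "is_EPS Z zero EPS \<phi> \<epsilon> q \<longleftrightarrow>
     (\<forall>s \<in> lists Z. range (EPS \<phi> \<epsilon> (shift_arg q s) s) \<subseteq> Z \<and>
        EPS \<phi> \<epsilon> (shift_arg q s) s = EPS_rhs zero \<phi> \<epsilon> (EPS \<phi> \<epsilon>) (shift_arg q s) s)"


section \<open>The realizer\<close>

type_synonym 'x Gfun = "(nat \<Rightarrow> 'x) \<Rightarrow> ((nat \<Rightarrow> nat) \<Rightarrow> nat) \<Rightarrow> nat \<Rightarrow> nat"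

text \<open>For \<open>g 0 = 0\<close> the prefix is empty, so the value of \<open>p\<close> at the index \<open>g 0 - 1\<close> does not matter.\<close>

definition pf_word :: "(nat \<Rightarrow> 'x W) \<Rightarrow> (nat \<Rightarrow> nat) \<Rightarrow> 'x W" where
  "pf_word p g = prefix (g 0) (p (g 0 - 1)) \<frown> (\<lambda>i. fts p (g i))"

definition phi_pf :: "(nat \<Rightarrow> 'x W) \<Rightarrow> (nat \<Rightarrow> 'x W \<Rightarrow> nat) \<Rightarrow> (nat \<Rightarrow> nat) \<Rightarrow> nat" where
  "phi_pf p f = (\<lambda>g. f (g 0) (pf_word p g))"

definition G_pf ::
  "'x \<Rightarrow> 'x Gfun \<Rightarrow> (nat \<Rightarrow> 'x W) \<Rightarrow> (nat \<Rightarrow> 'x W \<Rightarrow> nat) \<Rightarrow> nat \<Rightarrow> nat" where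
  "G_pf x0 G p f = G (lts x0 p) (phi_pf p f)"

definition Omega :: "'x \<Rightarrow> 'x Gfun \<Rightarrow> (nat \<Rightarrow> 'x Y) \<Rightarrow> nat" where
  "Omega x0 G \<alpha> =
     (let p = fst \<circ> \<alpha>; f = snd \<circ> \<alpha>; g = G_pf x0 G p f in g (phi_pf p f g) + 1)"

definition Phi :: "'x \<Rightarrow> 'x Gfun \<Rightarrow> (nat \<Rightarrow> 'x Y) \<Rightarrow> nat" where
  "Phi x0 G \<alpha> =
     (let p = fst \<circ> \<alpha>; f = snd \<circ> \<alpha>; g = G_pf x0 G p f in g (phi_pf p f g) + 1)"

definition Psi :: "'x \<Rightarrow> 'x Gfun \<Rightarrow> (nat \<Rightarrow> 'x Y) \<Rightarrow> 'x W" where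
  "Psi x0 G \<alpha> = (let p = fst \<circ> \<alpha>; f = snd \<circ> \<alpha> in pf_word p (G_pf x0 G p f))"

definition PhiPsi :: "'x \<Rightarrow> 'x Gfun \<Rightarrow> (nat \<Rightarrow> 'x Y) \<Rightarrow> nat \<times> 'x W" where
  "PhiPsi x0 G \<alpha> = (Phi x0 G \<alpha>, Psi x0 G \<alpha>)"

type_synonym 'x EPSfun =
  "((nat \<Rightarrow> 'x Y) \<Rightarrow> nat) \<Rightarrow> ('x Y list \<Rightarrow> ('x Y \<Rightarrow> nat \<times> 'x W) \<Rightarrow> 'x Y) \<Rightarrow>
   ((nat \<Rightarrow> 'x Y) \<Rightarrow> nat \<times> 'x W) \<Rightarrow> 'x Y list \<Rightarrow> nat \<Rightarrow> 'x Y"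

definition Gam ::
  "('x \<Rightarrow> 'x \<Rightarrow> bool) \<Rightarrow> 'x \<Rightarrow> 'x Gfun \<Rightarrow> 'x EPSfun \<Rightarrow> 'x W \<Rightarrow> nat" where
  "Gam le x0 G EPS u =
     Phi x0 G (EPS (Omega x0 G) (eps_tilde le u) (PhiPsi x0 G) [])"

section \<open>Existence of EPS for the continuous functionals\<close>

text \<open>
  The Kleene-Kreisel continuous functionals are presented by convergent sequences: base types are
  discrete, and functions carry continuous convergence. Each relation below is a limit structure
  \<open>C s a\<close> (the sequence \<open>s\<close> converges to \<open>a\<close>) whose objects are the \<open>a\<close> with \<open>C (\<lambda>_. a) a\<close>.
\<close>

definition conv_disc :: "(nat \<Rightarrow> 'a) \<Rightarrow> 'a \<Rightarrow> bool" where
  "conv_disc s a \<longleftrightarrow> (\<forall>\<^sub>F n in sequentially. s n = a)"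

definition conv_seq ::
  "((nat \<Rightarrow> 'a) \<Rightarrow> 'a \<Rightarrow> bool) \<Rightarrow> (nat \<Rightarrow> nat \<Rightarrow> 'a) \<Rightarrow> (nat \<Rightarrow> 'a) \<Rightarrow> bool" where
  "conv_seq C s a \<longleftrightarrow> (\<forall>i. C (\<lambda>n. s n i) (a i))"

definition conv_pair ::
  "((nat \<Rightarrow> 'a) \<Rightarrow> 'a \<Rightarrow> bool) \<Rightarrow> ((nat \<Rightarrow> 'b) \<Rightarrow> 'b \<Rightarrow> bool) \<Rightarrow>
   (nat \<Rightarrow> 'a \<times> 'b) \<Rightarrow> 'a \<times> 'b \<Rightarrow> bool" where
  "conv_pair C D s a \<longleftrightarrow> C (\<lambda>n. fst (s n)) (fst a) \<and> D (\<lambda>n. snd (s n)) (snd a)"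

definition cont_fun ::
  "((nat \<Rightarrow> 'a) \<Rightarrow> 'a \<Rightarrow> bool) \<Rightarrow> ((nat \<Rightarrow> 'b) \<Rightarrow> 'b \<Rightarrow> bool) \<Rightarrow> ('a \<Rightarrow> 'b) \<Rightarrow> bool" where
  "cont_fun C D f \<longleftrightarrow> (\<forall>s a. C s a \<longrightarrow> D (\<lambda>n. f (s n)) (f a))"

definition conv_fun ::
  "((nat \<Rightarrow> 'a) \<Rightarrow> 'a \<Rightarrow> bool) \<Rightarrow> ((nat \<Rightarrow> 'b) \<Rightarrow> 'b \<Rightarrow> bool) \<Rightarrow>
   (nat \<Rightarrow> 'a \<Rightarrow> 'b) \<Rightarrow> ('a \<Rightarrow> 'b) \<Rightarrow> bool" where
  "conv_fun C D F f \<longleftrightarrow> (\<forall>n. cont_fun C D (F n)) \<and> cont_fun C D f \<and>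
     (\<forall>s a. C s a \<longrightarrow> D (\<lambda>n. F n (s n)) (f a))"

abbreviation cW :: "(nat \<Rightarrow> nat \<Rightarrow> 'a) \<Rightarrow> (nat \<Rightarrow> 'a) \<Rightarrow> bool" where
  "cW \<equiv> conv_seq conv_disc"

abbreviation cF :: "(nat \<Rightarrow> 'x W \<Rightarrow> nat) \<Rightarrow> ('x W \<Rightarrow> nat) \<Rightarrow> bool" where
  "cF \<equiv> conv_fun cW conv_disc"

abbreviation cY :: "(nat \<Rightarrow> 'x Y) \<Rightarrow> 'x Y \<Rightarrow> bool" where
  "cY \<equiv> conv_pair cW cF"

abbreviation cR :: "(nat \<Rightarrow> nat \<times> 'x W) \<Rightarrow> nat \<times> 'x W \<Rightarrow> bool" where
  "cR \<equiv> conv_pair conv_disc cW"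

definition contY :: "'x Y set" where
  "contY = {y. cont_fun cW conv_disc (snd y)}"

definition continuous_G :: "'x Gfun \<Rightarrow> bool" where
  "continuous_G G \<longleftrightarrow> cont_fun cW (conv_fun (conv_fun cW conv_disc) cW) G"

lemma cont_funD: "cont_fun C D f \<Longrightarrow> C s a \<Longrightarrow> D (\<lambda>n. f (s n)) (f a)"
  by (simp add: cont_fun_def)

lemma conv_funD: "conv_fun C D F f \<Longrightarrow> C s a \<Longrightarrow> D (\<lambda>n. F n (s n)) (f a)"
  by (simp add: conv_fun_def)

lemma conv_fun_mem:
  "conv_fun C D F f \<Longrightarrow> cont_fun C D (F n)" "conv_fun C D F f \<Longrightarrow> cont_fun C D f"
  by (simp_all add: conv_fun_def)

lemma conv_funI:
  "(\<And>n. cont_fun C D (F n)) \<Longrightarrow> cont_fun C D f \<Longrightarrow>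
   (\<And>s a. C s a \<Longrightarrow> D (\<lambda>n. F n (s n)) (f a)) \<Longrightarrow> conv_fun C D F f"
  by (simp add: conv_fun_def)

lemma cW_iff: "cW s a \<longleftrightarrow> (\<forall>i. \<forall>\<^sub>F n in sequentially. s n i = a i)"
  by (simp add: conv_seq_def conv_disc_def)

lemma cW_const [simp]: "cW (\<lambda>_. a) a"
  by (simp add: cW_iff)

lemma conv_disc_const [simp]: "conv_disc (\<lambda>_. a) a"
  by (simp add: conv_disc_def)

lemma cW_ev: "cW s a \<Longrightarrow> \<forall>\<^sub>F n in sequentially. s' n = s n \<Longrightarrow> cW s' a"
  unfolding cW_iff by (auto elim: eventually_elim2)

lemma conv_disc_ev:
  "conv_disc s a \<Longrightarrow> \<forall>\<^sub>F n in sequentially. s' n = s n \<Longrightarrow> conv_disc s' a"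
  unfolding conv_disc_def by (auto elim: eventually_elim2)

lemma cF_ev:
  fixes a :: "'x W \<Rightarrow> nat"
  assumes "cF s a" "\<forall>\<^sub>F n in sequentially. s' n = s n" "\<And>n. cont_fun cW conv_disc (s' n)"
  shows "cF s' a"
  unfolding conv_fun_def
proof (intro conjI allI impI)
  fix t :: "nat \<Rightarrow> 'x W" and b assume "cW t b"
  then have "conv_disc (\<lambda>n. s n (t n)) (a b)" using assms(1) by (simp add: conv_fun_def)
  then show "conv_disc (\<lambda>n. s' n (t n)) (a b)"
    by (rule conv_disc_ev) (use assms(2) in \<open>auto elim: eventually_mono\<close>)
qed (use assms in \<open>auto simp: conv_fun_def\<close>)

lemma cY_ev:
  assumes "cY s a" "\<forall>\<^sub>F n in sequentially. s' n = s n" "\<And>n. s' n \<in> contY"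
  shows "cY s' a"
  using assms unfolding conv_pair_def contY_def
  by (auto intro!: cW_ev[where s = "\<lambda>n. fst (s n)"] cF_ev[where s = "\<lambda>n. snd (s n)"]
      elim: eventually_mono)

lemma cY_mem: "cY s a \<Longrightarrow> s n \<in> contY" "cY s a \<Longrightarrow> a \<in> contY"
  by (auto simp: conv_pair_def conv_fun_def contY_def)

lemma cF_const: "cont_fun cW conv_disc f \<Longrightarrow> cF (\<lambda>_. f) f"
  by (auto simp: conv_fun_def cont_fun_def)

lemma cY_const: "a \<in> contY \<Longrightarrow> cY (\<lambda>_. a) a"
  by (simp add: conv_pair_def contY_def cF_const)

lemma zeroY_cont: "zeroY \<in> contY"
  by (auto simp: zeroY_def contY_def cont_fun_def)

lemma seqY_ev:
  assumes "conv_seq cY s a" "\<forall>\<^sub>F n in sequentially. s' n = s n" "\<And>n i. s' n i \<in> contY"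
  shows "conv_seq cY s' a"
  unfolding conv_seq_def[of "conv_pair _ _"]
proof
  fix i
  show "cY (\<lambda>n. s' n i) (a i)"
    by (rule cY_ev[where s = "\<lambda>n. s n i"])
      (use assms in \<open>auto simp: conv_seq_def[of "conv_pair _ _"] elim: eventually_mono\<close>)
qed

definition cL :: "(nat \<Rightarrow> 'x Y list) \<Rightarrow> 'x Y list \<Rightarrow> bool" where
  "cL S s \<longleftrightarrow> (\<forall>n. length (S n) = length s) \<and> (\<forall>i<length s. cY (\<lambda>n. S n ! i) (s ! i))"

lemma cL_const: "s \<in> lists contY \<Longrightarrow> cL (\<lambda>_. s) s"
  by (auto simp: cL_def intro!: cY_const)

lemma lists_nthI: "(\<And>i. i < length s \<Longrightarrow> s ! i \<in> A) \<Longrightarrow> s \<in> lists A"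
  unfolding lists_eq_set by (auto simp only: set_conv_nth)

lemma cL_mem:
  assumes "cL S s"
  shows "S n \<in> lists contY" "s \<in> lists contY"
proof -
  have "S n ! i \<in> contY" "s ! i \<in> contY" if "i < length s" for i
    using assms that cY_mem(1)[of "\<lambda>n. S n ! i" "s ! i" n] cY_mem(2)[of "\<lambda>n. S n ! i" "s ! i"]
    by (simp_all add: cL_def)
  then show "S n \<in> lists contY" "s \<in> lists contY"
    using assms unfolding cL_def by (auto simp only: intro!: lists_nthI)
qed

lemma cL_snoc: "cL S s \<Longrightarrow> cY X x \<Longrightarrow> cL (\<lambda>n. S n @ [X n]) (s @ [x])"
  by (auto simp: cL_def nth_append less_Suc_eq)

lemma cL_conc:
  assumes "cL S s" "conv_seq cY T t"
  shows "conv_seq cY (\<lambda>n. S n \<frown> T n) (s \<frown> t)"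
  using assms by (auto simp: cL_def conv_seq_def conc_def)

lemma conc_single:
  assumes "cY X x" "conv_seq cY T t"
  shows "conv_seq cY (\<lambda>n. [X n] \<frown> T n) ([x] \<frown> t)"
  by (rule cL_conc) (use assms in \<open>auto simp: cL_def\<close>)

lemma conv_zero: "conv_seq cY (\<lambda>_ _. zeroY) (\<lambda>_. zeroY)"
  by (simp add: conv_seq_def cY_const zeroY_cont)

locale bar_rec =
  fixes \<phi> :: "(nat \<Rightarrow> 'x Y) \<Rightarrow> nat"
    and \<epsilon> :: "'x Y list \<Rightarrow> ('x Y \<Rightarrow> nat \<times> 'x W) \<Rightarrow> 'x Y"
    and q :: "(nat \<Rightarrow> 'x Y) \<Rightarrow> nat \<times> 'x W"
  assumes phi_cont: "\<And>S a. conv_seq cY S a \<Longrightarrow> conv_disc (\<lambda>n. \<phi> (S n)) (\<phi> a)"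
    and q_cont: "\<And>S a. conv_seq cY S a \<Longrightarrow> cR (\<lambda>n. q (S n)) (q a)"
    and eps_cont: "\<And>S s K k. cL S s \<Longrightarrow> conv_fun cY cR K k \<Longrightarrow> cY (\<lambda>n. \<epsilon> (S n) (K n)) (\<epsilon> s k)"
begin

abbreviation secured :: "'x Y list \<Rightarrow> bool" where
  "secured s \<equiv> \<phi> (s \<frown> (\<lambda>_. zeroY)) < length s"

definition kfun :: "('x Y list \<Rightarrow> nat \<Rightarrow> 'x Y) \<Rightarrow> 'x Y list \<Rightarrow> 'x Y \<Rightarrow> nat \<times> 'x W" where
  "kfun E s x = q (s \<frown> ([x] \<frown> E (s @ [x])))"

definition stepf :: "('x Y list \<Rightarrow> nat \<Rightarrow> 'x Y) \<Rightarrow> 'x Y list \<Rightarrow> nat \<Rightarrow> 'x Y" where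
  "stepf E s = (if secured s then (\<lambda>_. zeroY)
     else [\<epsilon> s (kfun E s)] \<frown> E (s @ [\<epsilon> s (kfun E s)]))"

fun appr :: "nat \<Rightarrow> 'x Y list \<Rightarrow> nat \<Rightarrow> 'x Y" where
  "appr 0 s = (\<lambda>_. zeroY)"
| "appr (Suc d) s = stepf (appr d) s"

lemma ev_secured: "cL S s \<Longrightarrow> \<forall>\<^sub>F n in sequentially. secured (S n) = secured s"
proof -
  assume a: "cL S s"
  have "conv_disc (\<lambda>n. \<phi> (S n \<frown> (\<lambda>_. zeroY))) (\<phi> (s \<frown> (\<lambda>_. zeroY)))"
    by (rule phi_cont, rule cL_conc[OF a conv_zero])
  then show ?thesis
    unfolding conv_disc_def by (rule eventually_mono) (use a in \<open>simp add: cL_def\<close>)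
qed

lemma kfun_conv:
  assumes "cL S s" "cY X x" "conv_seq cY (\<lambda>n. E n (S n @ [X n])) (e (s @ [x]))"
  shows "cR (\<lambda>n. kfun (E n) (S n) (X n)) (kfun e s x)"
  unfolding kfun_def by (intro q_cont cL_conc[OF assms(1)] conc_single[OF assms(2)] assms(3))

lemma stepf_mem:
  assumes s: "s \<in> lists contY" and k: "cont_fun cY cR (kfun E s)"
    and E: "\<And>x i. x \<in> contY \<Longrightarrow> E (s @ [x]) i \<in> contY"
  shows "stepf E s i \<in> contY"
proof -
  have "cY (\<lambda>_. \<epsilon> s (kfun E s)) (\<epsilon> s (kfun E s))"
    by (rule eps_cont[OF cL_const[OF s]]) (use k in \<open>auto simp: conv_fun_def cont_fun_def\<close>)
  then have "\<epsilon> s (kfun E s) \<in> contY" by (rule cY_mem)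
  then show ?thesis using E by (auto simp: stepf_def zeroY_cont conc_def)
qed

lemma stepf_conv:
  assumes S: "cL S s"
    and kn: "\<And>n. cont_fun cY cR (kfun (E n) (S n))" and k: "cont_fun cY cR (kfun e s)"
    and En: "\<And>n x i. x \<in> contY \<Longrightarrow> E n (S n @ [x]) i \<in> contY"
    and E: "\<And>X x. cY X x \<Longrightarrow> \<not> secured s \<Longrightarrow> conv_seq cY (\<lambda>n. E n (S n @ [X n])) (e (s @ [x]))"
  shows "conv_seq cY (\<lambda>n. stepf (E n) (S n)) (stepf e s)"
proof -
  have mem: "stepf (E n) (S n) i \<in> contY" for n i
    by (rule stepf_mem[of "S n" "E n"]) (rule cL_mem(1)[OF S], rule kn, erule En)
  show ?thesis
  proof (cases "secured s")
    case True
    show ?thesis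
    proof (rule seqY_ev[where s = "\<lambda>_ _. zeroY"])
      show "conv_seq cY (\<lambda>_ _. zeroY) (stepf e s)" using True by (simp add: stepf_def conv_zero)
      show "\<forall>\<^sub>F n in sequentially. stepf (E n) (S n) = (\<lambda>_. zeroY)"
        using ev_secured[OF S] by (rule eventually_mono) (use True in \<open>simp add: stepf_def\<close>)
      show "stepf (E n) (S n) i \<in> contY" for n i
        by (rule mem)
    qed
  next
    case False
    let ?a = "\<lambda>n. \<epsilon> (S n) (kfun (E n) (S n))" and ?b = "\<epsilon> s (kfun e s)"
    have "conv_fun cY cR (\<lambda>n. kfun (E n) (S n)) (kfun e s)"
      unfolding conv_fun_def[of cY]
    proof (intro conjI allI impI)
      show "cont_fun cY cR (kfun (E n) (S n))" for n by (rule kn)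
      show "cont_fun cY cR (kfun e s)" by (rule k)
      fix X and x :: "'x Y" assume X: "cY X x"
      show "cR (\<lambda>n. kfun (E n) (S n) (X n)) (kfun e s x)"
        by (rule kfun_conv[where E = E and S = S and X = X and e = e and s = s and x = x,
            OF S X E[OF X False]])
    qed
    then have a: "cY ?a ?b" by (rule eps_cont[OF S])
    have Ea: "conv_seq cY (\<lambda>n. E n (S n @ [?a n])) (e (s @ [?b]))" by (rule E[OF a False])
    show ?thesis
    proof (rule seqY_ev[where s = "\<lambda>n. [?a n] \<frown> E n (S n @ [?a n])"])
      show "conv_seq cY (\<lambda>n. [?a n] \<frown> E n (S n @ [?a n])) (stepf e s)"
        unfolding stepf_def if_not_P[OF False] by (rule conc_single[OF a Ea])
      show "\<forall>\<^sub>F n in sequentially. stepf (E n) (S n) = [?a n] \<frown> E n (S n @ [?a n])"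
        using ev_secured[OF S] by (rule eventually_mono) (use False in \<open>simp add: stepf_def\<close>)
      show "stepf (E n) (S n) i \<in> contY" for n i
        by (rule mem)
    qed
  qed
qed

lemma seqY_mem: "conv_seq cY T t \<Longrightarrow> t i \<in> contY" "conv_seq cY T t \<Longrightarrow> T n i \<in> contY"
  using cY_mem(2)[of "\<lambda>n. T n i" "t i"] cY_mem(1)[of "\<lambda>n. T n i" "t i" n]
  by (simp_all add: conv_seq_def)

lemma appr_conv: "cL S s \<Longrightarrow> conv_seq cY (\<lambda>n. appr d (S n)) (appr d s)"
proof (induction d arbitrary: S s)
  case 0
  show ?case by (simp add: conv_zero)
next
  case (Suc d)
  have k: "cont_fun cY cR (kfun (appr d) t)" if t: "t \<in> lists contY" for t
    unfolding cont_fun_def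
    by (intro allI impI kfun_conv[OF cL_const[OF t]] Suc.IH cL_snoc cL_const t)
  have m: "appr d (t @ [x]) i \<in> contY" if "t \<in> lists contY" "x \<in> contY" for t x i
    by (rule seqY_mem(1)[OF Suc.IH[OF cL_const]]) (use that in auto)
  have "conv_seq cY (\<lambda>n. stepf (appr d) (S n)) (stepf (appr d) s)"
  proof (rule stepf_conv[OF Suc.prems])
    show "cont_fun cY cR (kfun (appr d) (S n))" for n
      by (rule k[OF cL_mem(1)[OF Suc.prems]])
    show "cont_fun cY cR (kfun (appr d) s)"
      by (rule k[OF cL_mem(2)[OF Suc.prems]])
    show "appr d (S n @ [x]) i \<in> contY" if "x \<in> contY" for n x i
      by (rule m[OF cL_mem(1)[OF Suc.prems] that])
    show "conv_seq cY (\<lambda>n. appr d (S n @ [X n])) (appr d (s @ [x]))" if "cY X x" for X x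
      by (rule Suc.IH[OF cL_snoc[OF Suc.prems that]])
  qed
  then show ?case by simp
qed

lemma appr_mem: "s \<in> lists contY \<Longrightarrow> appr d s i \<in> contY"
  using appr_conv[of "\<lambda>_. s" s d] cL_const[of s] seqY_mem(1)[of "\<lambda>_. appr d s" "appr d s" i] by blast

lemma appr_kfun: "s \<in> lists contY \<Longrightarrow> cont_fun cY cR (kfun (appr d) s)"
  unfolding cont_fun_def
proof (intro allI impI)
  fix X and x :: "'x Y" assume s: "s \<in> lists contY" and X: "cY X x"
  show "cR (\<lambda>n. kfun (appr d) s (X n)) (kfun (appr d) s x)"
    by (rule kfun_conv[where E = "\<lambda>_. appr d", OF cL_const[OF s] X])
      (rule appr_conv[where S = "\<lambda>n. s @ [X n]", OF cL_snoc[OF cL_const[OF s] X]])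
qed

definition bar :: "('x Y list \<times> 'x Y list) set" where
  "bar = {(t, s). s \<in> lists contY \<and> \<not> secured s \<and> (\<exists>x\<in>contY. t = s @ [x])}"

lemma wf_bar: "wf bar"
  unfolding wf_iff_no_infinite_down_chain
proof (rule notI)
  assume "\<exists>f. \<forall>i. (f (Suc i), f i) \<in> bar"
  then obtain f where f: "\<And>i. (f (Suc i), f i) \<in> bar" by blast
  have mem: "f i \<in> lists contY" "\<not> secured (f i)" for i
    using f[of i] by (simp_all add: bar_def)
  have ex: "\<exists>x. f (Suc i) = f i @ [x]" for i using f[of i] by (auto simp: bar_def)
  have len: "length (f i) = length (f 0) + i" for i
    by (induction i) (use ex in \<open>auto, metis Suc_eq_plus1 length_append_singleton\<close>)
  have nth: "f (i + k) ! j = f i ! j" if "j < length (f i)" for i j k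
  proof (induction k)
    case (Suc k)
    obtain x where x: "f (Suc (i + k)) = f (i + k) @ [x]" using ex by blast
    have "j < length (f (i + k))" using that len[of i] len[of "i + k"] by simp
    then show ?case using x Suc by (simp add: nth_append)
  qed simp
  define \<alpha> where "\<alpha> j = f (Suc j) ! j" for j
  have "conv_seq cY (\<lambda>n. f n \<frown> (\<lambda>_. zeroY)) \<alpha>"
    unfolding conv_seq_def[of cY]
  proof
    fix i
    have li: "i < length (f n)" if "n \<ge> Suc i" for n using that len[of n] by simp
    have "\<alpha> i \<in> contY" unfolding \<alpha>_def using mem(1)[of "Suc i"] li[of "Suc i"]
      by (simp add: in_lists_conv_set)
    then have "cY (\<lambda>_. \<alpha> i) (\<alpha> i)" by (rule cY_const)
    then show "cY (\<lambda>n. (f n \<frown> (\<lambda>_. zeroY)) i) (\<alpha> i)"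
    proof (rule cY_ev)
      show "\<forall>\<^sub>F n in sequentially. (f n \<frown> (\<lambda>_. zeroY)) i = \<alpha> i"
        using eventually_ge_at_top[of "Suc i"]
      proof eventually_elim
        case (elim n)
        have "f n ! i = \<alpha> i"
          using nth[OF li[of "Suc i"], of "n - Suc i"] elim by (simp add: \<alpha>_def)
        then show ?case using li[OF elim] by (simp add: conc_def)
      qed
      show "(f n \<frown> (\<lambda>_. zeroY)) i \<in> contY" for n
        using mem(1)[of n] by (auto simp: conc_def zeroY_cont in_lists_conv_set)
    qed
  qed
  from phi_cont[OF this] have "\<forall>\<^sub>F n in sequentially. \<phi> (f n \<frown> (\<lambda>_. zeroY)) = \<phi> \<alpha>"
    by (simp add: conv_disc_def)
  then have "\<forall>\<^sub>F n in sequentially. secured (f n)"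
    using eventually_gt_at_top[of "\<phi> \<alpha>"]
  proof eventually_elim
    case (elim n)
    then show ?case using len[of n] by simp
  qed
  then show False using mem(2) by (simp add: eventually_sequentially)
qed

definition sol :: "'x Y list \<Rightarrow> nat \<Rightarrow> 'x Y" where
  "sol = wfrec bar (\<lambda>E s. if s \<in> lists contY then stepf E s else undefined)"

lemma sol_outside: "s \<notin> lists contY \<Longrightarrow> sol s = undefined"
  unfolding sol_def by (subst wfrec[OF wf_bar]) simp

lemma sol_eq:
  assumes s: "s \<in> lists contY"
  shows "sol s = stepf sol s"
proof -
  have c: "cut sol bar s (s @ [x]) = sol (s @ [x])" if "\<not> secured s" for x
  proof (cases "x \<in> contY")
    case True
    then show ?thesis using that s by (simp add: cut_def bar_def)
  next
    case False
    then have "s @ [x] \<notin> lists contY" by simp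
    moreover from this have "(s @ [x], s) \<notin> bar" using s by (simp add: bar_def)
    ultimately show ?thesis by (simp add: cut_def sol_outside)
  qed
  have "sol s = stepf (cut sol bar s) s"
    unfolding sol_def by (subst wfrec[OF wf_bar]) (use s in simp)
  also have "\<dots> = stepf sol s"
  proof (cases "secured s")
    case False
    then have "kfun (cut sol bar s) s = kfun sol s" by (simp add: kfun_def fun_eq_iff c)
    with False show ?thesis by (simp add: stepf_def c)
  qed (simp add: stepf_def)
  finally show ?thesis .
qed

lemma appr_step: "1 \<le> d \<Longrightarrow> appr d s = stepf (appr (d - 1)) s"
  by (cases d) simp_all

lemma sol_limit:
  assumes "s \<in> lists contY"
  shows "\<forall>S d. cL S s \<longrightarrow> filterlim d at_top sequentially \<longrightarrow>
           conv_seq cY (\<lambda>n. appr (d n) (S n)) (sol s)"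
  using wf_bar assms
proof (induction s rule: wf_induct_rule)
  case (less s)
  note s = less.prems
  have IH: "conv_seq cY (\<lambda>n. appr (d n) (S n)) (sol (s @ [x]))"
    if "x \<in> contY" "\<not> secured s" "cL S (s @ [x])" "filterlim d at_top sequentially" for x S d
    using less.IH[of "s @ [x]"] that s by (auto simp: bar_def)
  show ?case
  proof (intro allI impI)
    fix S d assume S: "cL S s" and d: "filterlim (d :: nat \<Rightarrow> nat) at_top sequentially"
    let ?E = "\<lambda>n. appr (d n - 1)"
    have d1: "filterlim (\<lambda>n. d n - 1) at_top sequentially"
      using d unfolding filterlim_at_top
    proof (intro allI)
      fix Z assume "\<forall>Z. \<forall>\<^sub>F n in sequentially. Z \<le> d n"
      then have "\<forall>\<^sub>F n in sequentially. Suc Z \<le> d n" by blast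
      then show "\<forall>\<^sub>F n in sequentially. Z \<le> d n - 1" by (rule eventually_mono) simp
    qed
    have conv: "conv_seq cY (\<lambda>n. stepf (?E n) (S n)) (sol s)"
    proof (cases "secured s")
      case True
      show ?thesis
      proof (rule seqY_ev[where s = "\<lambda>_ _. zeroY"])
        show "conv_seq cY (\<lambda>_ _. zeroY) (sol s)"
          using True by (simp add: sol_eq[OF s] stepf_def conv_zero)
        show "\<forall>\<^sub>F n in sequentially. stepf (?E n) (S n) = (\<lambda>_. zeroY)"
          using ev_secured[OF S] by (rule eventually_mono) (use True in \<open>simp add: stepf_def\<close>)
        show "stepf (?E n) (S n) i \<in> contY" for n i
          by (rule stepf_mem[where E = "?E n" and s = "S n"])
            (use cL_mem(1)[OF S, of n] in \<open>simp_all add: appr_kfun appr_mem\<close>)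
      qed
    next
      case False
      have k: "cont_fun cY cR (kfun sol s)"
        unfolding cont_fun_def
      proof (intro allI impI)
        fix X and x :: "'x Y" assume X: "cY X x"
        have xm: "X n \<in> contY" "x \<in> contY" for n using cY_mem[OF X] by auto
        have diag: "cR (\<lambda>n. kfun (appr (e n)) s (X n)) (kfun sol s x)"
          if "filterlim e at_top sequentially" for e
          by (rule kfun_conv[where E = "\<lambda>n. appr (e n)", OF cL_const[OF s] X])
            (rule IH[OF xm(2) False cL_snoc[OF cL_const[OF s] X] that])
        have pt: "cR (\<lambda>n. kfun (appr n) s (X j)) (kfun sol s (X j))" for j
          by (rule kfun_conv[where E = appr, OF cL_const[OF s] cY_const[OF xm(1)]])
            (rule IH[OF xm(1) False cL_snoc[OF cL_const[OF s] cY_const[OF xm(1)]] filterlim_ident])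
        have sel: "\<exists>e. filterlim e at_top sequentially \<and> (\<forall>j. P (e j) j)"
          if ev: "\<And>j. \<forall>\<^sub>F n in sequentially. P n j" for P :: "nat \<Rightarrow> nat \<Rightarrow> bool"
        proof -
          have "\<exists>n\<ge>j. P n j" for j
          proof -
            obtain N where "\<forall>n\<ge>N. P n j" using ev[of j] by (auto simp: eventually_sequentially)
            then have "P (max N j) j" by simp
            then show ?thesis by (intro exI[of _ "max N j"]) simp
          qed
          then obtain e where e: "\<And>j. e j \<ge> j \<and> P (e j) j" by metis
          have "filterlim e at_top sequentially"
            by (rule filterlim_at_top_mono[OF filterlim_ident]) (use e in auto)
          then show ?thesis using e by blast
        qed
        show "cR (\<lambda>n. kfun sol s (X n)) (kfun sol s x)"
          unfolding conv_pair_def conv_seq_def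
        proof (intro conjI allI)
          obtain e where e: "filterlim e at_top sequentially"
            "\<And>j. fst (kfun (appr (e j)) s (X j)) = fst (kfun sol s (X j))"
            using sel[of "\<lambda>n j. fst (kfun (appr n) s (X j)) = fst (kfun sol s (X j))"] pt
            by (auto simp: conv_pair_def conv_disc_def)
          show "conv_disc (\<lambda>n. fst (kfun sol s (X n))) (fst (kfun sol s x))"
            using diag[OF e(1)] by (simp add: conv_pair_def e(2))
        next
          fix i
          obtain e where e: "filterlim e at_top sequentially"
            "\<And>j. snd (kfun (appr (e j)) s (X j)) i = snd (kfun sol s (X j)) i"
            using sel[of "\<lambda>n j. snd (kfun (appr n) s (X j)) i = snd (kfun sol s (X j)) i"] pt
            by (auto simp: conv_pair_def cW_iff)
          show "conv_disc (\<lambda>n. snd (kfun sol s (X n)) i) (snd (kfun sol s x) i)"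
          proof -
            have "cW (\<lambda>n. snd (kfun (appr (e n)) s (X n))) (snd (kfun sol s x))"
              using diag[OF e(1)] unfolding conv_pair_def by (rule conjunct2)
            then have "conv_disc (\<lambda>n. snd (kfun (appr (e n)) s (X n)) i) (snd (kfun sol s x) i)"
              unfolding conv_seq_def by (rule spec)
            then show ?thesis by (simp only: e(2))
          qed
        qed
      qed
      have "conv_seq cY (\<lambda>n. stepf (?E n) (S n)) (stepf sol s)"
      proof (rule stepf_conv[where E = ?E and e = sol and S = S and s = s, OF S _ k])
        show "cont_fun cY cR (kfun (?E n) (S n))" for n
          by (rule appr_kfun[OF cL_mem(1)[OF S]])
        show "?E n (S n @ [x]) i \<in> contY" if "x \<in> contY" for n x i
          by (rule appr_mem) (use that cL_mem(1)[OF S, of n] in simp)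
        show "conv_seq cY (\<lambda>n. ?E n (S n @ [X n])) (sol (s @ [x]))" if "cY X x" for X x
          by (rule IH[OF cY_mem(2)[OF that] False cL_snoc[OF S that] d1])
      qed
      then show ?thesis by (simp add: sol_eq[OF s])
    qed
    show "conv_seq cY (\<lambda>n. appr (d n) (S n)) (sol s)"
    proof (rule seqY_ev[OF conv])
      have "\<forall>\<^sub>F n in sequentially. 1 \<le> d n" using d by (simp add: filterlim_at_top)
      then show "\<forall>\<^sub>F n in sequentially. appr (d n) (S n) = stepf (?E n) (S n)"
        by (rule eventually_mono) (rule appr_step)
      show "appr (d n) (S n) i \<in> contY" for n i
        by (rule appr_mem[OF cL_mem(1)[OF S]])
    qed
  qed
qed

lemma sol_mem: "s \<in> lists contY \<Longrightarrow> sol s i \<in> contY"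
  using sol_limit[of s, rule_format, OF _ cL_const filterlim_ident, THEN seqY_mem(1)] .

lemma is_EPS_sol: "is_EPS contY zeroY (\<lambda>_ _ _. sol) \<phi> \<epsilon> q"
  unfolding is_EPS_def
proof (intro ballI conjI)
  fix s :: "'x Y list" assume s: "s \<in> lists contY"
  then show "range (sol s) \<subseteq> contY" using sol_mem by blast
  have k: "(\<lambda>x. shift_arg (shift_arg q s) [x] (sol (s @ [x]))) = kfun sol s"
    by (simp add: shift_arg_def kfun_def fun_eq_iff)
  show "sol s = EPS_rhs zeroY \<phi> \<epsilon> (\<lambda>_. sol) (shift_arg q s) s"
    unfolding EPS_rhs_def k Let_def by (subst sol_eq[OF s]) (simp add: stepf_def)
qed

end

lemma prefix_eq_iff: "prefix n (v :: nat \<Rightarrow> 'a) = prefix n w \<longleftrightarrow> (\<forall>i<n. v i = w i)"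
  by (auto simp: list_eq_iff_nth_eq)

lemma pf_word_conv:
  assumes p: "\<And>i. cW (\<lambda>n. p n i) (p' i)" and g: "cW g g'"
  shows "cW (\<lambda>n. pf_word (p n) (g n)) (pf_word p' g')"
  unfolding cW_iff
proof
  fix i
  have "\<forall>\<^sub>F n in sequentially. g n 0 = g' 0" "\<forall>\<^sub>F n in sequentially. g n (i - g' 0) = g' (i - g' 0)"
    using g by (simp_all add: cW_iff)
  moreover have "\<forall>\<^sub>F n in sequentially. p n (g' 0 - 1) i = p' (g' 0 - 1) i"
    using p by (simp add: cW_iff)
  moreover have "\<forall>\<^sub>F n in sequentially.
      p n (g' (i - g' 0)) (g' (i - g' 0)) = p' (g' (i - g' 0)) (g' (i - g' 0))"
    using p by (simp add: cW_iff)
  ultimately show "\<forall>\<^sub>F n in sequentially. pf_word (p n) (g n) i = pf_word p' g' i"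
    by eventually_elim (simp add: pf_word_def conc_def fts_def)
qed

lemma phi_pf_conv_pt:
  assumes p: "\<And>i. cW (\<lambda>n. p n i) (p' i)" and f: "\<And>i. cF (\<lambda>n. f n i) (f' i)" and g: "cW g g'"
  shows "conv_disc (\<lambda>n. phi_pf (p n) (f n) (g n)) (phi_pf p' f' g')"
proof -
  have "\<forall>\<^sub>F n in sequentially. f n (g' 0) (pf_word (p n) (g n)) = f' (g' 0) (pf_word p' g')"
    using f[of "g' 0"] pf_word_conv[OF p g] by (simp add: conv_fun_def conv_disc_def)
  moreover have "\<forall>\<^sub>F n in sequentially. g n 0 = g' 0" using g by (simp add: cW_iff)
  ultimately show ?thesis
    unfolding conv_disc_def phi_pf_def by eventually_elim simp
qed

lemma phi_pf_conv:
  assumes p: "\<And>i. cW (\<lambda>n. p n i) (p' i)" and f: "\<And>i. cF (\<lambda>n. f n i) (f' i)"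
  shows "conv_fun cW conv_disc (\<lambda>n. phi_pf (p n) (f n)) (phi_pf p' f')"
proof -
  have c: "cont_fun cW conv_disc (phi_pf r h)" if h: "\<And>i. cont_fun cW conv_disc (h i)" for r h
    unfolding cont_fun_def
    by (intro allI impI, rule phi_pf_conv_pt[where p = "\<lambda>_. r" and f = "\<lambda>_. h"])
      (simp, rule cF_const, rule h)
  show ?thesis
  proof (rule conv_funI)
    show "cont_fun cW conv_disc (phi_pf (p n) (f n))" for n
      by (rule c[OF conv_fun_mem(1)[OF f]])
    show "cont_fun cW conv_disc (phi_pf p' f')"
      by (rule c[OF conv_fun_mem(2)[OF f]])
    show "conv_disc (\<lambda>n. phi_pf (p n) (f n) (s n)) (phi_pf p' f' a)" if "cW s a" for s a
      by (rule phi_pf_conv_pt[where p = p and f = f, OF p f that])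
  qed
qed

lemma G_pf_conv:
  assumes G: "continuous_G G" and p: "\<And>i. cW (\<lambda>n. p n i) (p' i)"
    and f: "\<And>i. cF (\<lambda>n. f n i) (f' i)"
  shows "cW (\<lambda>n. G_pf x0 G (p n) (f n)) (G_pf x0 G p' f')"
proof -
  have l: "cW (\<lambda>n. lts x0 (p n)) (lts x0 p')"
    unfolding cW_iff
  proof
    fix i
    have "\<forall>\<^sub>F n in sequentially. p n i i = p' i i" using p by (simp add: cW_iff)
    then show "\<forall>\<^sub>F n in sequentially. lts x0 (p n) i = lts x0 p' i"
      by eventually_elim (simp add: lts_def)
  qed
  have "conv_fun (conv_fun cW conv_disc) cW (\<lambda>n. G (lts x0 (p n))) (G (lts x0 p'))"
    by (rule cont_funD[OF G[unfolded continuous_G_def], OF l])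
  from conv_funD[OF this, OF phi_pf_conv[where p = p and f = f, OF p f]]
  show ?thesis unfolding G_pf_def .
qed

lemma conv_Y_seqD:
  assumes "conv_seq cY S a"
  shows "cW (\<lambda>n. (fst \<circ> S n) i) ((fst \<circ> a) i)" "cF (\<lambda>n. (snd \<circ> S n) i) ((snd \<circ> a) i)"
  using assms by (simp_all add: conv_seq_def[of "conv_pair _ _"] conv_pair_def)

lemma Omega_conv:
  assumes G: "continuous_G G" and S: "conv_seq cY S a"
  shows "conv_disc (\<lambda>n. Omega x0 G (S n)) (Omega x0 G a)"
proof -
  note pf = conv_Y_seqD[OF S]
  let ?g = "\<lambda>n. G_pf x0 G (fst \<circ> S n) (snd \<circ> S n)" and ?h = "G_pf x0 G (fst \<circ> a) (snd \<circ> a)"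
  have g: "cW ?g ?h" by (rule G_pf_conv[where p = "\<lambda>n. fst \<circ> S n" and f = "\<lambda>n. snd \<circ> S n", OF G pf])
  let ?m = "phi_pf (fst \<circ> a) (snd \<circ> a) ?h"
  have "\<forall>\<^sub>F n in sequentially. phi_pf (fst \<circ> S n) (snd \<circ> S n) (?g n) = ?m"
    using phi_pf_conv_pt[where p = "\<lambda>n. fst \<circ> S n" and p' = "fst \<circ> a"
        and f = "\<lambda>n. snd \<circ> S n" and f' = "snd \<circ> a", OF pf g] by (simp add: conv_disc_def)
  moreover have "\<forall>\<^sub>F n in sequentially. ?g n ?m = ?h ?m" using g by (simp add: cW_iff)
  ultimately show ?thesis
    unfolding conv_disc_def Omega_def Let_def by eventually_elim simp
qed

lemma PhiPsi_conv:
  assumes G: "continuous_G G" and S: "conv_seq cY S a"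
  shows "cR (\<lambda>n. PhiPsi x0 G (S n)) (PhiPsi x0 G a)"
proof -
  note pf = conv_Y_seqD[OF S]
  have "Phi x0 G = Omega x0 G" by (simp add: Phi_def Omega_def fun_eq_iff)
  moreover have "cW (\<lambda>n. G_pf x0 G (fst \<circ> S n) (snd \<circ> S n)) (G_pf x0 G (fst \<circ> a) (snd \<circ> a))"
    by (rule G_pf_conv[where p = "\<lambda>n. fst \<circ> S n" and f = "\<lambda>n. snd \<circ> S n", OF G pf])
  then have "cW (\<lambda>n. Psi x0 G (S n)) (Psi x0 G a)"
    unfolding Psi_def Let_def by (rule pf_word_conv[where p = "\<lambda>n. fst \<circ> S n", OF pf(1)])
  ultimately show ?thesis
    unfolding conv_pair_def PhiPsi_def fst_conv snd_conv using Omega_conv[OF G S, of x0] by simp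
qed

lemma sel_f_cont:
  fixes J :: "'x Y \<Rightarrow> nat"
  assumes J: "cont_fun cY conv_disc J"
  shows "cont_fun cW conv_disc (sel_f J i)"
proof (induction i)
  case 0
  show ?case by (simp add: cont_fun_def)
next
  case (Suc i)
  show ?case
    unfolding cont_fun_def
  proof (intro allI impI)
    fix s :: "nat \<Rightarrow> 'x W" and b assume "cW s b"
    then have "cY (\<lambda>n. (s n, sel_f J i)) (b, sel_f J i)"
      using cF_const[OF Suc] by (simp add: conv_pair_def)
    from cont_funD[OF J, OF this]
    show "conv_disc (\<lambda>n. sel_f J (Suc i) (s n)) (sel_f J (Suc i) b)" by simp
  qed
qed

lemma sel_f_conv:
  fixes J :: "nat \<Rightarrow> 'x Y \<Rightarrow> nat"
  assumes J: "conv_fun cY conv_disc J j"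
  shows "cF (\<lambda>n. sel_f (J n) i) (sel_f j i)"
proof (induction i)
  case 0
  show ?case by (simp add: conv_fun_def cont_fun_def)
next
  case (Suc i)
  show ?case
  proof (rule conv_funI)
    show "cont_fun cW conv_disc (sel_f (J n) (Suc i))" for n
      by (rule sel_f_cont[OF conv_fun_mem(1)[OF J]])
    show "cont_fun cW conv_disc (sel_f j (Suc i))"
      by (rule sel_f_cont[OF conv_fun_mem(2)[OF J]])
    fix s :: "nat \<Rightarrow> 'x W" and b assume "cW s b"
    then have "cY (\<lambda>n. (s n, sel_f (J n) i)) (b, sel_f j i)"
      using Suc by (simp add: conv_pair_def)
    from conv_funD[OF J, OF this]
    show "conv_disc (\<lambda>n. sel_f (J n) (Suc i) (s n)) (sel_f j (Suc i) b)" by simp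
  qed
qed

lemma sel_p_down_conv:
  fixes J :: "nat \<Rightarrow> 'x Y \<Rightarrow> nat"
  assumes J: "conv_fun cY conv_disc J j" and Q: "conv_fun cY cW Q q" and w: "cW w v"
  shows "cW (\<lambda>n. sel_p_down (J n) (Q n) (w n) N k) (sel_p_down j q v N k)"
proof (induction k)
  case 0
  show ?case using w by simp
next
  case (Suc k)
  have "cY (\<lambda>n. (sel_p_down (J n) (Q n) (w n) N k, sel_f (J n) (N - k)))
          (sel_p_down j q v N k, sel_f j (N - k))"
    using Suc sel_f_conv[OF J] by (simp add: conv_pair_def)
  from conv_funD[OF Q, OF this] show ?case by simp
qed

lemma A_pred_cong:
  assumes "\<And>j. j \<le> max n k \<Longrightarrow> r j = r' j" "\<And>j. j \<le> n \<Longrightarrow> w j = w' j"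
  shows "A_pred le n w m r k = A_pred le n w' m r' k"
proof -
  have "ext_at n r w = ext_at n r' w'"
    using assms by (simp add: ext_at_def prefix_eq_iff)
  moreover have "theta le r k = theta le r' k"
    unfolding theta_def using assms(1) by (metis le_trans less_imp_le max.cobounded2)
  ultimately show ?thesis using assms(1)[of n] by (simp add: A_pred_def)
qed

lemma A_pred_ev:
  assumes r: "cW r r'" and k: "conv_disc k k'" and w: "cW w w'"
  shows "\<forall>\<^sub>F l in sequentially. A_pred le n (w l) m (r l) (k l) = A_pred le n w' m r' k'"
proof -
  have "\<forall>\<^sub>F l in sequentially. \<forall>j\<in>{..max n k'}. r l j = r' j"
    by (rule eventually_ball_finite) (use r in \<open>simp_all add: cW_iff\<close>)
  moreover have "\<forall>\<^sub>F l in sequentially. \<forall>j\<in>{..n}. w l j = w' j"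
    by (rule eventually_ball_finite) (use w in \<open>simp_all add: cW_iff\<close>)
  moreover have "\<forall>\<^sub>F l in sequentially. k l = k'" using k by (simp add: conv_disc_def)
  ultimately show ?thesis
  proof eventually_elim
    case (elim l)
    then show ?case using A_pred_cong[of n k' "r l" r' "w l" w' le m] by auto
  qed
qed

lemma eps_conv:
  assumes w: "cW w v" and K: "conv_fun cY cR K k"
  shows "cY (\<lambda>l. eps le n (w l) (K l)) (eps le n v k)"
proof -
  define J where "J l y = fst (K l y)" for l y
  define Q where "Q l y = snd (K l y)" for l y
  define j where "j y = fst (k y)" for y
  define q where "q y = snd (k y)" for y
  have J: "conv_fun cY conv_disc J j" and Q: "conv_fun cY cW Q q"
    using K unfolding conv_fun_def[of cY] cont_fun_def[of cY] J_def Q_def j_def q_def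
      conv_pair_def[of conv_disc cW] by blast+
  define N where "N = length (v n)"
  define P where "P l = sel_p (J l) (Q l) (w l) N" for l
  define p where "p = sel_p j q v N"
  define X where "X l i = Q l (P l i, sel_f (J l) i)" for l i
  define x where "x i = q (p i, sel_f j i)" for i
  define I where "I = (GREATEST i. i \<le> N \<and> \<not> A_pred le n v i (x i) (sel_f j i (x i)))"
  have Nl: "\<forall>\<^sub>F l in sequentially. length (w l n) = N"
    using w unfolding cW_iff N_def by (auto elim!: allE[of _ n] eventually_mono)
  have P: "cY (\<lambda>l. (P l i, sel_f (J l) i)) (p i, sel_f j i)" for i
    using sel_p_down_conv[OF J Q w] sel_f_conv[OF J]
    by (simp add: P_def p_def sel_p_def conv_pair_def)
  then have X: "cW (\<lambda>l. X l i) (x i)" for i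
    unfolding X_def x_def by (rule conv_funD[OF Q])
  then have Fx: "conv_disc (\<lambda>l. sel_f (J l) i (X l i)) (sel_f j i (x i))" for i
    by (rule conv_funD[OF sel_f_conv[OF J]])
  have "\<forall>\<^sub>F l in sequentially. \<forall>i\<in>{..N}.
      A_pred le n (w l) i (X l i) (sel_f (J l) i (X l i)) =
      A_pred le n v i (x i) (sel_f j i (x i))"
    by (rule eventually_ball_finite) (use A_pred_ev[OF X Fx w] in auto)
  then have ev: "\<forall>\<^sub>F l in sequentially. eps le n (w l) (K l) = (P l I, sel_f (J l) I)"
    using Nl
  proof eventually_elim
    case (elim l)
    have "(GREATEST i. i \<le> N \<and> \<not> A_pred le n (w l) i (X l i) (sel_f (J l) i (X l i))) = I"
      unfolding I_def by (rule arg_cong[where f = Greatest]) (use elim(1) in auto)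
    moreover have "(\<lambda>y. fst (K l y)) = J l" "(\<lambda>y. snd (K l y)) = Q l"
      by (simp_all add: J_def Q_def fun_eq_iff)
    ultimately show ?case
      using elim(2) by (simp add: eps_def Let_def P_def X_def)
  qed
  have "(\<lambda>y. fst (k y)) = j" "(\<lambda>y. snd (k y)) = q" by (simp_all add: j_def q_def fun_eq_iff)
  then have e: "eps le n v k = (p I, sel_f j I)"
    by (simp add: eps_def Let_def N_def[symmetric] p_def x_def I_def)
  have "eps le n (w l) (K l) \<in> contY" for l
  proof -
    have "cont_fun cY conv_disc (J l)" using J by (simp add: conv_fun_def)
    then have "cont_fun cY conv_disc (\<lambda>y. fst (K l y))" by (simp add: J_def[abs_def])
    then show ?thesis by (simp add: eps_def Let_def contY_def sel_f_cont)
  qed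
  then show ?thesis
    unfolding e by (rule cY_ev[OF P ev])
qed

lemma eps_tilde_conv:
  assumes S: "cL S s" and K: "conv_fun cY cR K k"
  shows "cY (\<lambda>n. eps_tilde le u (S n) (K n)) (eps_tilde le u s k)"
proof -
  have len: "length (S n) = length s" for n using S by (simp add: cL_def)
  then have emp: "S n = [] \<longleftrightarrow> s = []" for n by (metis length_0_conv)
  have "cW (\<lambda>n. if s = [] then u else fst (S n ! (length s - 1)))
          (if s = [] then u else fst (s ! (length s - 1)))"
    using S by (auto simp: cL_def conv_pair_def)
  from eps_conv[OF this K, of le "length s"] show ?thesis
    unfolding eps_tilde_def len emp .
qed

theorem EPS_exists:
  assumes "continuous_G G"
  shows "\<exists>EPS. \<forall>u. is_EPS contY zeroY EPS (Omega x0 G) (eps_tilde le u) (PhiPsi x0 G)"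
proof -
  have "is_EPS contY zeroY (\<lambda>\<phi> \<epsilon> _. bar_rec.sol \<phi> \<epsilon> (PhiPsi x0 G))
          (Omega x0 G) (eps_tilde le u) (PhiPsi x0 G)" for u
  proof -
    interpret bar_rec "Omega x0 G" "eps_tilde le u" "PhiPsi x0 G"
      by unfold_locales (intro Omega_conv PhiPsi_conv eps_tilde_conv assms; assumption)+
    show ?thesis using is_EPS_sol unfolding is_EPS_def .
  qed
  then show ?thesis by blast
qed
end

theory Submission
  imports Defs
begin

text \<open>
  Suppose \<open>u\<close> is bad up to \<open>\<Gamma>(u)\<close>, and let \<open>(p\<^sup>n, f\<^sup>n)\<close> be the sequence computed by \<open>EPS\<close>. Up to the
  stopping point \<open>\<Omega>\<close> it behaves like an approximation to Nash-Williams' minimal bad sequence: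
  \<open>p\<^sup>n\<close> is bad up to \<open>\<Gamma>(u)\<close>, arises from \<open>p\<^sup>n\<^sup>-\<^sup>1\<close> by truncating the word at index \<open>n\<close> (and changing later
  words), and the particular sequence \<open>\<psi>\<close> given by \<open>\<Psi>\<close>, if shorter at index \<open>n\<close>, is not bad up to
  \<open>f\<^sup>n \<psi>\<close>. For \<open>n = G 0\<close> the latter applies, as \<open>\<psi>\<close> arises by removing last letters; and the monotone
  subsequence \<open>G\<close> of last letters turns a pair \<open>\<psi>\<^sub>i \<le> \<psi>\<^sub>j\<close> into such a pair in some \<open>p\<^sup>k\<close>.
\<close>

section \<open>Embeddings of words\<close>

lemma word_le_Nil: "word_le le [] b"
  by (simp add: word_le_def)

lemma word_le_butlastD:
  assumes "word_le le a (butlast b)"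
  shows "word_le le a b"
proof -
  obtain f where f: "f ` {..<length a} \<subseteq> {..<length (butlast b)}"
      "strict_mono_on {..<length a} f" "\<And>i. i < length a \<Longrightarrow> le (a ! i) (butlast b ! f i)"
    using assms by (auto simp: word_le_def)
  have "f i < length b - 1" if "i < length a" for i
    using f(1) that by auto
  then have "f ` {..<length a} \<subseteq> {..<length b}" "\<And>i. i < length a \<Longrightarrow> le (a ! i) (b ! f i)"
    using f(3) by (fastforce, simp add: nth_butlast)
  then show ?thesis
    using f(2) by (auto simp: word_le_def)
qed

lemma word_le_snoc:
  assumes "word_le le a b" and "le x y"
  shows "word_le le (a @ [x]) (b @ [y])"
proof -
  obtain f where f: "\<And>i. i < length a \<Longrightarrow> f i < length b"
      "strict_mono_on {..<length a} f" "\<And>i. i < length a \<Longrightarrow> le (a ! i) (b ! f i)"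
    using assms(1) by (auto simp: word_le_def)
  define g where "g = f(length a := length b)"
  have "strict_mono_on {..<length (a @ [x])} g"
    using f(1,2) by (auto simp: strict_mono_on_def g_def less_Suc_eq)
  moreover have "g ` {..<length (a @ [x])} \<subseteq> {..<length (b @ [y])}"
    using f(1) by (auto simp: g_def less_Suc_eq)
  moreover have "le ((a @ [x]) ! i) ((b @ [y]) ! g i)" if "i < length (a @ [x])" for i
    using f(1,3) assms(2) that by (auto simp: g_def nth_append less_Suc_eq)
  ultimately show ?thesis
    unfolding word_le_def by blast
qed

lemma word_le_butlast_last:
  assumes "a \<noteq> []" "b \<noteq> []" "word_le le (butlast a) (butlast b)" "le (last a) (last b)"
  shows "word_le le a b"
  using word_le_snoc[OF assms(3,4)] assms(1,2) by simp

lemma thetaD: "theta le v j \<Longrightarrow> i0 < i1 \<Longrightarrow> i1 \<le> j \<Longrightarrow> \<not> word_le le (v i0) (v i1)"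
  by (simp add: theta_def)

lemma ext_refl: "ext a a"
  by (simp add: ext_def)

lemma ext_trans: "ext a b \<Longrightarrow> ext b c \<Longrightarrow> ext a c"
  by (auto simp: ext_def)

lemma ext_butlast: "ext (butlast a) a"
  by (simp add: ext_def nth_butlast)

lemma ext_at_refl: "ext_at n w w"
  by (simp add: ext_at_def ext_refl)

section \<open>The selection functions\<close>

text \<open>If the greatest failing index \<open>i\<close> is below \<open>length (w n)\<close>, the
  predicate holds at \<open>Suc i\<close>. There the downward recursion for the sequences returns
  \<open>p\<close>, and the upward one for the bounds gives \<open>J (p, f) = m\<close>.\<close>

lemma eps_cases:
  assumes e: "eps le n w K = (p, f)" and K: "K (p, f) = (m, r)"
  obtains i where "\<not> A_pred le n w i r (f r)"
    and "p = w \<and> i = length (w n) \<or> A_pred le n w (Suc i) p m"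
proof -
  define J where "J = (\<lambda>y. fst (K y))"
  define Q where "Q = (\<lambda>y. snd (K y))"
  define N where "N = length (w n)"
  define P where "P = sel_p J Q w N"
  define F where "F = sel_f J"
  define B where "B i \<longleftrightarrow> i \<le> N \<and> \<not> A_pred le n w i (Q (P i, F i)) (F i (Q (P i, F i)))" for i
  define i where "i = Greatest B"
  have pf: "p = P i" "f = F i"
    using e by (simp_all add: eps_def Let_def B_def[abs_def] i_def P_def F_def J_def Q_def N_def)
  \<comment> \<open>No length is below \<open>0\<close>, so a greatest index exists.\<close>
  have "B 0" by (simp add: B_def A_pred_def)
  moreover have bd: "\<And>k. B k \<Longrightarrow> k \<le> N" by (simp add: B_def)
  ultimately have "B i"
    unfolding i_def by (rule GreatestI_nat)
  have "Q (p, f) = r" "J (p, f) = m"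
    using K by (simp_all add: Q_def J_def)
  show thesis
  proof (rule that[of i])
    show "\<not> A_pred le n w i r (f r)"
      using \<open>B i\<close> \<open>Q (p, f) = r\<close> by (simp add: B_def pf)
    show "p = w \<and> i = length (w n) \<or> A_pred le n w (Suc i) p m"
    proof (cases "i = N")
      case True
      then show ?thesis by (simp add: pf P_def sel_p_def N_def)
    next
      case False
      then have "Suc i \<le> N" using \<open>B i\<close> by (simp add: B_def)
      have "\<not> B (Suc i)"
        using Greatest_le_nat[of B "Suc i" N] bd unfolding i_def[symmetric] by auto
      then have "A_pred le n w (Suc i) (Q (P (Suc i), F (Suc i))) (F (Suc i) (Q (P (Suc i), F (Suc i))))"
        using \<open>Suc i \<le> N\<close> by (simp add: B_def)
      moreover have "N - i = Suc (N - Suc i)"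
        using \<open>Suc i \<le> N\<close> by simp
      then have "Q (P (Suc i), F (Suc i)) = p"
        using \<open>Suc i \<le> N\<close> by (simp add: pf P_def F_def sel_p_def del: sel_f.simps)
      moreover have "F (Suc i) p = m"
        using \<open>J (p, f) = m\<close> by (simp add: F_def pf)
      ultimately show ?thesis by simp
    qed
  qed
qed

text \<open>In both cases of \<open>eps_cases\<close>, \<open>length (p n) \<le> i\<close>. So if
  \<open>r\<close> is shorter than \<open>p\<close> at \<open>n\<close> and
  \<open>ext_at n r w\<close> holds, the failure of \<open>A_pred\<close> at \<open>i\<close> can
  only come from \<open>theta\<close>.\<close>

lemma eps_minimal:
  assumes "eps le n w K = (p, f)" "K (p, f) = (m, r)" "theta le w m"
  shows "theta le p m" "ext_at n p w"
    "ext_at n r w \<Longrightarrow> length (r n) < length (p n) \<Longrightarrow> \<not> theta le r (f r)"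
proof -
  obtain i where i: "\<not> A_pred le n w i r (f r)"
      "p = w \<and> i = length (w n) \<or> A_pred le n w (Suc i) p m"
    using eps_cases[OF assms(1,2)] .
  show "theta le p m" "ext_at n p w"
    using i(2) assms(3) by (auto simp: A_pred_def ext_at_refl)
  show "\<not> theta le r (f r)" if "ext_at n r w" "length (r n) < length (p n)"
    using i that by (auto simp: A_pred_def)
qed

section \<open>The product of selection functions\<close>

lemma shift_arg_append: "shift_arg (shift_arg q s) t = shift_arg q (s @ t)"
  by (simp add: shift_arg_def)

text \<open>Each tail of \<open>\<alpha>\<close> up to \<open>\<phi> \<alpha>\<close> is the
  \<open>EPS\<close> value at the preceding prefix. Hence every such entry is selected against a
  continuation \<open>K\<close> which, at that entry, rebuilds all of
  \<open>\<alpha>\<close>.\<close>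

lemma is_EPS_nth:
  assumes E: "is_EPS Z zero EPS \<phi> \<epsilon> q" and \<alpha>: "\<alpha> = EPS \<phi> \<epsilon> q []" and "n \<le> \<phi> \<alpha>"
  shows "\<exists>K. \<alpha> n = \<epsilon> (prefix n \<alpha>) K \<and> K (\<alpha> n) = q \<alpha>"
proof -
  have nil: "shift_arg q [] = q" by (simp add: shift_arg_def)
  let ?E = "\<lambda>s. EPS \<phi> \<epsilon> (shift_arg q s) s"
  have "range (?E []) \<subseteq> Z" using E unfolding is_EPS_def by blast
  \<comment> \<open>The defining equation is given only on lists over \<open>Z\<close>; the range
    condition puts every prefix of \<open>\<alpha>\<close> there.\<close>
  then have Z: "prefix k \<alpha> \<in> lists Z" for k
    unfolding nil \<alpha>[symmetric] by (auto simp: in_lists_conv_set)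
  define K where "K k x = shift_arg q (prefix k \<alpha> @ [x]) (?E (prefix k \<alpha> @ [x]))" for k x
  have unfold: "suffix k \<alpha> = [\<epsilon> (prefix k \<alpha>) (K k)] \<frown>
        ?E (prefix k \<alpha> @ [\<epsilon> (prefix k \<alpha>) (K k)])"
    if k: "k \<le> \<phi> \<alpha>" and s: "?E (prefix k \<alpha>) = suffix k \<alpha>" for k
  proof -
    have rhs: "?E (prefix k \<alpha>) = EPS_rhs zero \<phi> \<epsilon> (EPS \<phi> \<epsilon>) (shift_arg q (prefix k \<alpha>)) (prefix k \<alpha>)"
      using E Z[of k] unfolding is_EPS_def by blast
    \<comment> \<open>Stopping at \<open>k\<close> would make the tail zero, so the padded prefix
      would be \<open>\<alpha>\<close> itself and \<open>\<phi> \<alpha> < k\<close>.\<close>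
    have "\<not> \<phi> (prefix k \<alpha> \<frown> (\<lambda>_. zero)) < k"
    proof
      assume "\<phi> (prefix k \<alpha> \<frown> (\<lambda>_. zero)) < k"
      moreover from this have "suffix k \<alpha> = (\<lambda>_. zero)"
        using rhs s by (simp add: EPS_rhs_def)
      then have "prefix k \<alpha> \<frown> (\<lambda>_. zero) = \<alpha>"
        using prefix_suffix[of \<alpha> k] by simp
      ultimately show False using k by simp
    qed
    then show ?thesis
      using rhs s by (simp add: EPS_rhs_def Let_def shift_arg_append K_def[abs_def])
  qed
  have nth: "\<alpha> k = \<epsilon> (prefix k \<alpha>) (K k)" "?E (prefix (Suc k) \<alpha>) = suffix (Suc k) \<alpha>"
    if "k \<le> \<phi> \<alpha>" "?E (prefix k \<alpha>) = suffix k \<alpha>" for k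
  proof -
    note u = unfold[OF that]
    show a: "\<alpha> k = \<epsilon> (prefix k \<alpha>) (K k)"
      using fun_cong[OF u, of 0] by simp
    have "suffix (Suc k) \<alpha> i = ?E (prefix (Suc k) \<alpha>) i" for i
      using fun_cong[OF u, of "Suc i"] a by (simp add: conc_def)
    then show "?E (prefix (Suc k) \<alpha>) = suffix (Suc k) \<alpha>" by auto
  qed
  have tail: "?E (prefix k \<alpha>) = suffix k \<alpha>" if "k \<le> \<phi> \<alpha>" for k
    using that
  proof (induction k)
    case 0
    show ?case by (simp add: nil \<alpha>)
  next
    case (Suc k)
    then show ?case by (intro nth(2)) auto
  qed
  note n = nth[OF assms(3) tail[OF assms(3)]]
  have "K n (\<alpha> n) = q (prefix (Suc n) \<alpha> \<frown> suffix (Suc n) \<alpha>)"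
    using n(2) by (simp add: K_def shift_arg_def)
  then have "K n (\<alpha> n) = q \<alpha>"
    by (simp only: prefix_suffix[symmetric])
  then show ?thesis
    using n(1) by blast
qed

section \<open>Minimal bad sequences\<close>

lemma pf_word_nth:
  "pf_word p g i = (if i < g 0 then p (g 0 - 1) i else fts p (g (i - g 0)))"
  by (simp add: pf_word_def conc_def)

lemma ext_at_nth: "ext_at n v w \<Longrightarrow> i < n \<Longrightarrow> v i = w i"
  by (simp add: ext_at_def prefix_eq_iff)

text \<open>Here \<open>p 0\<close> is the starting sequence \<open>u\<close>, so that \<open>p (Suc n)\<close> is \<open>p\<^sup>n\<close> in the paper.\<close>

lemma minimal_bad_sequence:
  fixes p :: "nat \<Rightarrow> nat \<Rightarrow> 'x list" and g :: "nat \<Rightarrow> nat" and f :: "nat \<Rightarrow> (nat \<Rightarrow> 'x list) \<Rightarrow> nat"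
  defines "r \<equiv> pf_word (\<lambda>n. p (Suc n)) g"
  defines "M \<equiv> f (g 0) r"
  defines "m \<equiv> g M + 1"
  assumes bad: "\<And>n. n \<le> Suc m \<Longrightarrow> theta le (p n) m"
    and ext: "\<And>n. n \<le> m \<Longrightarrow> ext_at n (p (Suc n)) (p n)"
    and mini: "\<And>n. n \<le> m \<Longrightarrow> ext_at n r (p n) \<Longrightarrow> length (r n) < length (p (Suc n) n) \<Longrightarrow>
                 \<not> theta le r (f n r)"
    and g: "\<And>i j. i < j \<Longrightarrow> j \<le> M \<Longrightarrow>
              g i < g j \<and> le (lts x0 (\<lambda>n. p (Suc n)) (g i)) (lts x0 (\<lambda>n. p (Suc n)) (g j))"
  shows False
proof -
  define n where "n = g 0"
  have gM: "g i \<le> g M" if "i \<le> M" for i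
    using g[of i M] that by (cases "i = M") auto
  have g0: "n \<le> g i" if "i \<le> M" for i
    using g[of 0 i] that by (cases "i = 0") (auto simp: n_def)
  \<comment> \<open>Stage \<open>Suc k\<close> changes nothing below index \<open>k\<close>, so word
    \<open>i\<close> is settled from stage \<open>Suc i\<close> on.\<close>
  have stable: "p k i = p j i" if "i < j" "j \<le> k" "k \<le> Suc m" for i j k
    using that(2,3)
  proof (induction k rule: dec_induct)
    case (step k)
    then show ?case using ext_at_nth[OF ext, of k i] that(1) by simp
  qed simp
  \<comment> \<open>An empty word would embed into its right neighbour; as \<open>m\<close> is one
    above \<open>g M\<close>, that neighbour still lies in the bad range.\<close>
  have ne: "p (Suc k) k \<noteq> []" if "k \<le> g M" for k
    using thetaD[OF bad, of "Suc k" k "Suc k"] that word_le_Nil[of le] by (auto simp: m_def)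
  \<comment> \<open>Here \<open>n > 0\<close>, so the sequence from which \<open>pf_word\<close>
    takes its prefix is \<open>p (Suc (n - 1)) = p n\<close>.\<close>
  have r_lt: "r i = p n i" if "i < n" for i
    using that by (simp add: r_def pf_word_nth n_def)
  have r_ge: "r i = butlast (p (Suc (g (i - n))) (g (i - n)))" if "n \<le> i" for i
    using that by (simp add: r_def pf_word_nth fts_def n_def)
  have nm: "n \<le> g M" by (simp add: g0)
  have rn: "r n = butlast (p (Suc n) n)" using r_ge[of n] by (simp add: n_def)
  have "ext (p (Suc n) n) (p n n)"
    using ext[of n] nm by (simp add: m_def ext_at_def)
  then have "ext_at n r (p n)"
    using r_lt ext_trans[OF ext_butlast] by (simp add: ext_at_def prefix_eq_iff rn)
  moreover have "length (r n) < length (p (Suc n) n)"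
    using ne[OF nm] by (simp add: rn)
  \<comment> \<open>At \<open>n = g 0\<close> the bound \<open>f n r\<close> is \<open>M\<close>
    itself, so the resulting pair lies in the range where \<open>g\<close> is controlled.\<close>
  ultimately have "\<not> theta le r M"
    using mini[of n] nm by (simp add: m_def M_def n_def)
  then obtain i j where ij: "i < j" "j \<le> M" "word_le le (r i) (r j)"
    by (auto simp: theta_def)
  consider "j < n" | "i < n" "n \<le> j" | "n \<le> i" by linarith
  then show False
  proof cases
    case 1
    then show False
      using thetaD[OF bad, of n i j] ij nm by (simp add: r_lt m_def)
  next
    case 2
    define k where "k = g (j - n)"
    have k: "n \<le> k" "k \<le> g M" using g0[of "j - n"] gM[of "j - n"] ij by (simp_all add: k_def)
    \<comment> \<open>Restoring the last letter of word \<open>j\<close> keeps the embedding;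
      \<open>stable\<close> then carries word \<open>i\<close> into \<open>p (Suc k)\<close> as
      well.\<close>
    have "word_le le (p n i) (p (Suc k) k)"
      using ij(3) r_lt r_ge 2 by (auto simp: k_def intro: word_le_butlastD)
    moreover have "p n i = p (Suc k) i" using stable[of i n "Suc k"] 2 k by (simp add: m_def)
    ultimately show False
      using thetaD[OF bad, of "Suc k" i k] 2 k by (simp add: m_def)
  next
    case 3
    define a b where "a = g (i - n)" and "b = g (j - n)"
    have ab: "a < b" "le (lts x0 (\<lambda>n. p (Suc n)) a) (lts x0 (\<lambda>n. p (Suc n)) b)"
      using g[of "i - n" "j - n"] 3 ij by (simp_all add: a_def b_def)
    have b: "b \<le> g M" using gM[of "j - n"] ij by (simp add: b_def)
    have "p (Suc a) a \<noteq> []" "p (Suc b) b \<noteq> []" using ne ab b by auto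
    \<comment> \<open>Both words lost their last letters, which are comparable along
      \<open>g\<close>; putting them back extends the embedding.\<close>
    then have "word_le le (p (Suc a) a) (p (Suc b) b)"
      using word_le_butlast_last[of "p (Suc a) a" "p (Suc b) b" le] ij r_ge[of i] r_ge[of j] 3 ab(2)
      by (simp add: a_def b_def lts_def last_default_def)
    moreover have "p (Suc a) a = p (Suc b) a"
      using stable[of a "Suc a" "Suc b"] ab b by (simp add: m_def)
    ultimately show False
      using thetaD[OF bad, of "Suc b" a b] ab b by (simp add: m_def)
  qed
qed

theorem theorem4:
  fixes le :: "'x \<Rightarrow> 'x \<Rightarrow> bool" and x0 :: 'x
    and G :: "(nat \<Rightarrow> 'x) \<Rightarrow> ((nat \<Rightarrow> nat) \<Rightarrow> nat) \<Rightarrow> nat \<Rightarrow> nat"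
    and Z :: "'x Y set" and EPS :: "'x EPSfun"
  assumes "wqo le"
    and "\<forall>x \<phi> i j. i < j \<and> j \<le> \<phi> (G x \<phi>) \<longrightarrow>
           G x \<phi> i < G x \<phi> j \<and> le (x (G x \<phi> i)) (x (G x \<phi> j))"
    and "\<forall>u. is_EPS Z zeroY EPS (Omega x0 G) (eps_tilde le u) (PhiPsi x0 G)"
  shows "\<forall>u :: nat \<Rightarrow> 'x list. \<exists>i0 i1. i0 < i1 \<and> i1 \<le> Gam le x0 G EPS u \<and> word_le le (u i0) (u i1)"
proof (rule allI, rule ccontr)
  fix u :: "nat \<Rightarrow> 'x list"
  assume contr: "\<nexists>i0 i1. i0 < i1 \<and> i1 \<le> Gam le x0 G EPS u \<and> word_le le (u i0) (u i1)"
  define \<alpha> where "\<alpha> = EPS (Omega x0 G) (eps_tilde le u) (PhiPsi x0 G) []"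
  define f where "f = snd \<circ> \<alpha>"
  \<comment> \<open>Prepending \<open>u\<close> absorbs the case of the empty list in
    \<open>eps_tilde\<close>.\<close>
  define p where "p = case_nat u (fst \<circ> \<alpha>)"
  have p_Suc: "(\<lambda>n. p (Suc n)) = fst \<circ> \<alpha>" by (simp add: p_def fun_eq_iff)
  define g where "g = G_pf x0 G (fst \<circ> \<alpha>) f"
  define r where "r = pf_word (\<lambda>n. p (Suc n)) g"
  define m where "m = g (f (g 0) r) + 1"
  have M: "f (g 0) r = phi_pf (fst \<circ> \<alpha>) f g"
    by (simp add: r_def p_Suc phi_pf_def)
  have m: "Omega x0 G \<alpha> = m" "Phi x0 G \<alpha> = m" and r: "Psi x0 G \<alpha> = r"
    by (simp_all add: Omega_def Phi_def Psi_def Let_def m_def phi_pf_def g_def f_def r_def p_Suc)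
  \<comment> \<open>The outcome \<open>(m, r)\<close> is the same for all \<open>n \<le> m\<close>,
    so a single bound and a single competitor serve every stage.\<close>
  have step: "\<exists>K. eps le n (p n) K = (p (Suc n), f n) \<and> K (p (Suc n), f n) = (m, r)" if n: "n \<le> m" for n
  proof -
    obtain K where K: "\<alpha> n = eps_tilde le u (prefix n \<alpha>) K" "K (\<alpha> n) = PhiPsi x0 G \<alpha>"
      using is_EPS_nth[where EPS = EPS and \<phi> = "Omega x0 G" and \<epsilon> = "eps_tilde le u"
          and q = "PhiPsi x0 G", OF assms(3)[rule_format, of u] \<alpha>_def n[folded m(1)]] by blast
    have "(if prefix n \<alpha> = [] then u else fst (prefix n \<alpha> ! (length (prefix n \<alpha>) - 1))) = p n"
      by (cases n) (simp_all add: p_def nth_append)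
    then have "\<alpha> n = eps le n (p n) K"
      using K(1) by (simp add: eps_tilde_def)
    moreover have "\<alpha> n = (p (Suc n), f n)" by (simp add: p_def f_def)
    ultimately show ?thesis
      using K(2) by (auto simp: PhiPsi_def m r)
  qed
  have "theta le u m"
    using contr m by (auto simp: theta_def Gam_def \<alpha>_def)
  have bad: "theta le (p n) m" if "n \<le> Suc m" for n
    using that
  proof (induction n)
    case 0
    then show ?case using \<open>theta le u m\<close> by (simp add: p_def)
  next
    case (Suc n)
    then show ?case using step[of n] eps_minimal(1) by auto
  qed
  show False
  proof (rule minimal_bad_sequence[of g f p le x0, folded r_def, folded m_def])
    show "theta le (p n) m" if "n \<le> Suc m" for n using bad[OF that] .
    show "ext_at n (p (Suc n)) (p n)" if "n \<le> m" for n
      using step[OF that] eps_minimal(2) bad[of n] that by fastforce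
    show "\<not> theta le r (f n r)"
      if "n \<le> m" "ext_at n r (p n)" "length (r n) < length (p (Suc n) n)" for n
      using step[OF that(1)] eps_minimal(3) bad[of n] that by fastforce
    \<comment> \<open>By \<open>M\<close>, the bound \<open>f (g 0) r\<close> is
      \<open>phi_pf\<close> evaluated at \<open>g\<close>, which is exactly the range covered by the
      hypothesis on \<open>G\<close>.\<close>
    show "g i < g j \<and> le (lts x0 (\<lambda>n. p (Suc n)) (g i)) (lts x0 (\<lambda>n. p (Suc n)) (g j))"
      if "i < j" "j \<le> f (g 0) r" for i j
      using assms(2)[rule_format, of i j "phi_pf (fst \<circ> \<alpha>) f" "lts x0 (fst \<circ> \<alpha>)"] that
      unfolding M p_Suc G_pf_def[symmetric] g_def[symmetric] by blast
  qed
qed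

end
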